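(* Let $k\ge 0$ be an integer. The number of nice order ideals of the poset $M_{2k+1,2k+3}$ equals $\displaystyle\sum_{i=0}^{k}\frac{1}{i+1}\binom{2i}{i}\binom{2k-2i}{k-i}$.
   Context: For coprime positive integers $s,t$, let $P_{s,t}=\mathbb{N}^+\setminus\{k_1s+k_2t\mid k_1,k_2\in\mathbb{N}\}$ (with $\mathbb N=\{0,1,2,\dots\}$), partially ordered by the reflexive-transitive closure of the cover relation: $x$ covers $y$ (for $x,y\in P_{s,t}$) iff $x-y\in\{s,t\}$. An order ideal of a poset is a subset $I$ such that $y\in I$ and $x\preceq y$ imply $x\in I$. An order ideal $I$ of a poset whose elements are integers is nice if there are no $x,y\in I$ with $x-y=1$. $M_{2k+1,2k+3}$ is the subposet of $P_{2k+1,2k+3}$ obtained by removing all elements $y$ with $y\succeq 2k+2$ (with the induced order). *)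

theory Defs
  imports Complex_Main
begin

definition gap_set :: "nat \<Rightarrow> nat \<Rightarrow> nat set" where
  "gap_set s t = {n. 0 < n} - {k1 * s + k2 * t | k1 k2. True}"

text \<open>Orders are relations whose pairs \<open>(y, x)\<close> mean that \<open>y\<close> is below \<open>x\<close>;
  here \<open>(y, x)\<close> is in the relation iff \<open>x\<close> covers \<open>y\<close>.
  The difference condition is written additively to avoid truncated subtraction.\<close>

definition gap_cover :: "nat \<Rightarrow> nat \<Rightarrow> nat rel" where
  "gap_cover s t = {(y, x). y \<in> gap_set s t \<and> x \<in> gap_set s t \<and> (x = y + s \<or> x = y + t)}"

text \<open>The restriction discards the reflexive pairs that \<open>rtrancl\<close> adds outside the carrier.\<close>

definition gap_le :: "nat \<Rightarrow> nat \<Rightarrow> nat rel" where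
  "gap_le s t = Restr ((gap_cover s t)\<^sup>*) (gap_set s t)"

definition M_set :: "nat \<Rightarrow> nat set" where
  "M_set k = {y \<in> gap_set (2 * k + 1) (2 * k + 3).
                (2 * k + 2, y) \<notin> gap_le (2 * k + 1) (2 * k + 3)}"

definition M_le :: "nat \<Rightarrow> nat rel" where
  "M_le k = Restr (gap_le (2 * k + 1) (2 * k + 3)) (M_set k)"

definition order_ideal :: "'a set \<Rightarrow> 'a rel \<Rightarrow> 'a set \<Rightarrow> bool" where
  "order_ideal A r I \<longleftrightarrow> I \<subseteq> A \<and> (\<forall>y\<in>I. \<forall>x\<in>A. (x, y) \<in> r \<longrightarrow> x \<in> I)"

definition nice :: "nat set \<Rightarrow> bool" where
  "nice I \<longleftrightarrow> \<not> (\<exists>x\<in>I. \<exists>y\<in>I. x = y + 1)"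

end

theory Submission
  imports Defs "HOL-Computational_Algebra.Formal_Power_Series"
begin

text \<open>Write elements as \<open>m s + n\<close> with \<open>s = 2 k + 1\<close> and \<open>n < s\<close>. The poset \<open>M\<close> consists of the points
  with \<open>2 m < n\<close>, and adding \<open>s\<close> or \<open>s + 2\<close> moves \<open>(m, n)\<close> to \<open>(m + 1, n)\<close> or \<open>(m + 1, n + 2)\<close>.
  An order ideal is therefore given by its column heights \<open>h n\<close>, subject to \<open>h (n + 2) \<le> h n + 1\<close>,
  and it is nice iff no two adjacent columns are both nonempty. Scanning the columns from left to
  right, only the last two heights matter, one of which is zero; the resulting recurrence
  is solved by binomial coefficients and yields \<open>2 k + 1 choose k\<close>. The convolution of Catalan numbers
  with central binomial coefficients has the same value, by Vandermonde's identity for the exponents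
  \<open>1/2\<close> and \<open>-1/2\<close>.\<close>

section \<open>The convolution\<close>

text \<open>Pascal's rule splits the central coefficient into two entries of an odd row, which agree
  by symmetry.\<close>

lemma binomial_Suc_times_two: "2 * (Suc (2 * n) choose n) = (2 * Suc n) choose Suc n"
proof -
  have "Suc (2 * n) choose Suc n = Suc (2 * n) choose n"
    using binomial_symmetric[of n "Suc (2 * n)"] by (simp add: Suc_diff_le)
  then show ?thesis by simp
qed

lemma central_binomial_Suc:
  "Suc n * ((2 * Suc n) choose Suc n) = 2 * (2 * n + 1) * ((2 * n) choose n)"
proof -
  have "Suc n * (Suc (2 * n) choose n) = Suc (2 * n) * ((2 * n) choose n)"
    using binomial_absorb_comp[of "Suc (2 * n)" n] by (simp add: Suc_diff_le)
  then show ?thesis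
    unfolding binomial_Suc_times_two[symmetric] by simp
qed

text \<open>Coefficients of \<open>1 - 4x\<close> raised to -1/2. Both sides start at 1 and have the
  same successive ratios, because \<open>(- 1 / 2 - n) * (- 4) = 2 * (2 * n + 1)\<close>.\<close>

lemma gbinomial_minus_half:
  "((- 1 / 2 :: real) gchoose n) * (- 4) ^ n = real ((2 * n) choose n)"
proof (induction n)
  case 0
  show ?case by simp
next
  case (Suc n)
  let ?a = "- 1 / 2 :: real"
  have rec: "real (Suc n) * (?a gchoose Suc n) = (?a - real n) * (?a gchoose n)"
    using gbinomial_absorption[of n ?a] gbinomial_absorb_comp[of ?a n] by simp
  have "real (Suc n) * ((?a gchoose Suc n) * (- 4) ^ Suc n) =
      (real (Suc n) * (?a gchoose Suc n)) * (- 4) * (- 4) ^ n"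
    by (simp only: power_Suc mult_ac)
  also have "\<dots> = (?a - real n) * (- 4) * ((?a gchoose n) * (- 4) ^ n)"
    by (simp only: rec mult_ac)
  also have "\<dots> = real (2 * (2 * n + 1) * ((2 * n) choose n))"
    unfolding Suc by (simp add: algebra_simps)
  also have "\<dots> = real (Suc n) * real ((2 * Suc n) choose Suc n)"
    unfolding central_binomial_Suc[symmetric] by (simp only: of_nat_mult)
  finally show ?case by (simp only: mult_cancel_left) simp
qed

text \<open>Absorption lowers the exponent 1/2 to -1/2. In generating functions: the square root of
  \<open>1 - 4x\<close> is \<open>1 - 2x C(x)\<close> with the Catalan series
  \<open>C\<close>.\<close>

lemma catalan_gbinomial_half:
  "((1 / 2 :: real) gchoose Suc i) * (- 4) ^ Suc i =
    - 2 * (1 / real (i + 1) * real ((2 * i) choose i))"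
proof -
  have "real (Suc i) * ((1 / 2 :: real) gchoose Suc i) = 1 / 2 * ((- 1 / 2) gchoose i)"
    using gbinomial_absorption[of i "1 / 2 :: real"] by simp
  then have half: "1 / real (i + 1) * ((- 1 / 2) gchoose i) = 2 * ((1 / 2 :: real) gchoose Suc i)"
    by (simp add: field_simps)
  have "- 2 * (1 / real (i + 1) * (((- 1 / 2) gchoose i) * (- 4) ^ i)) =
      - 2 * (1 / real (i + 1) * ((- 1 / 2) gchoose i)) * (- 4) ^ i"
    by (simp only: mult.assoc)
  also have "\<dots> = ((1 / 2) gchoose Suc i) * (- 4) ^ Suc i"
    unfolding half by simp
  finally show ?thesis
    unfolding gbinomial_minus_half by (rule sym)
qed

lemma catalan_central_convolution:
  "(\<Sum>i=0..k. 1 / real (i + 1) * real ((2 * i) choose i) * real ((2 * k - 2 * i) choose (k - i)))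
    = real ((2 * k + 1) choose k)" (is "?S = _")
proof -
  let ?h = "\<lambda>j. ((1 / 2 :: real) gchoose j) * (- 4) ^ j"
  let ?m = "\<lambda>j. ((- 1 / 2 :: real) gchoose j) * (- 4) ^ j"
  \<comment> \<open>The exponents add up to 0, so the Vandermonde sum vanishes at every positive
    index. The index is \<open>Suc k\<close> because Catalan numbers sit one place higher in the
    expansion for 1/2.\<close>
  have "0 = (\<Sum>j=0..Suc k. ((1 / 2 :: real) gchoose j) * ((- 1 / 2) gchoose (Suc k - j))) * (- 4) ^ Suc k"
    by (simp only: gbinomial_Vandermonde) (simp add: gbinomial_0_left)
  also have "\<dots> = (\<Sum>j=0..Suc k. ?h j * ?m (Suc k - j))"
    unfolding sum_distrib_right
  proof (rule sum.cong)
    fix j assume "j \<in> {0..Suc k}"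
    then have "(- 4 :: real) ^ Suc k = (- 4) ^ j * (- 4) ^ (Suc k - j)"
      by (simp only: power_add[symmetric]) simp
    then show "((1 / 2 :: real) gchoose j) * ((- 1 / 2) gchoose (Suc k - j)) * (- 4) ^ Suc k =
        ?h j * ?m (Suc k - j)"
      by simp
  qed simp
  also have "\<dots> = ?m (Suc k) + (\<Sum>i=0..k. ?h (Suc i) * ?m (k - i))"
    by (simp add: sum.atLeast0_atMost_Suc_shift del: sum.cl_ivl_Suc power_Suc)
  also have "\<dots> = real ((2 * Suc k) choose Suc k) - 2 * ?S"
    unfolding gbinomial_minus_half catalan_gbinomial_half
    by (simp add: sum_distrib_left diff_mult_distrib2 sum_negf mult.assoc)
  finally have "2 * ?S = real (2 * (Suc (2 * k) choose k))"
    unfolding binomial_Suc_times_two by linarith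
  then show ?thesis by simp
qed

section \<open>Column heights\<close>

text \<open>The arguments \<open>u\<close> and \<open>v\<close> are the heights of the two columns preceding the list.\<close>

fun valid :: "nat \<Rightarrow> nat \<Rightarrow> nat list \<Rightarrow> bool" where
  "valid u v [] \<longleftrightarrow> True"
| "valid u v (w # ws) \<longleftrightarrow> w \<le> u + 1 \<and> (w = 0 \<or> v = 0) \<and> valid v w ws"

definition valid_lists :: "nat \<Rightarrow> nat \<Rightarrow> nat \<Rightarrow> nat list set" where
  "valid_lists N u v = {ws. length ws = N \<and> valid u v ws}"

lemma valid_lists_0: "valid_lists 0 u v = {[]}"
  by (auto simp: valid_lists_def)

lemma valid_lists_Suc:
  "valid_lists (Suc N) u v =
    (\<Union>w\<in>{w. w \<le> u + 1 \<and> (w = 0 \<or> v = 0)}. (#) w ` valid_lists N v w)"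
  by (auto simp: valid_lists_def length_Suc_conv image_iff)

lemma finite_valid_lists: "finite (valid_lists N u v)"
  by (induction N arbitrary: u v) (auto simp: valid_lists_0 valid_lists_Suc)

lemma card_valid_lists_Suc:
  "card (valid_lists (Suc N) u v) =
    (\<Sum>w\<in>{w. w \<le> u + 1 \<and> (w = 0 \<or> v = 0)}. card (valid_lists N v w))"
  unfolding valid_lists_Suc
  by (subst card_UN_disjoint) (auto simp: finite_valid_lists card_image)

lemma card_valid_lists_Suc_0:
  "card (valid_lists (Suc N) u 0) =
    card (valid_lists N 0 0) + (\<Sum>w\<le>u. card (valid_lists N 0 (Suc w)))"
proof -
  have "{w. w \<le> u + 1 \<and> (w = 0 \<or> (0::nat) = 0)} = {..Suc u}"
    by auto
  then show ?thesis
    by (simp add: card_valid_lists_Suc sum.atMost_Suc_shift del: sum.atMost_Suc)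
qed

lemma card_valid_lists_Suc_Suc:
  "card (valid_lists (Suc N) u (Suc v)) = card (valid_lists N (Suc v) 0)"
proof -
  have "{w. w \<le> u + 1 \<and> (w = 0 \<or> Suc v = 0)} = {0}"
    by auto
  then show ?thesis
    by (simp add: card_valid_lists_Suc)
qed

text \<open>A hockey-stick sum started at \<open>n\<close>; it telescopes by Pascal's rule.\<close>

lemma sum_binomial_upper:
  "(n choose Suc r) + (\<Sum>v\<le>u. (n + v) choose r) = (n + Suc u) choose Suc r"
  by (induction u) auto

text \<open>For even \<open>N\<close> the two lower indices coincide and the doubling identity
  applies; for odd \<open>N\<close> they are adjacent and this is Pascal's rule.\<close>

lemma binomial_half_Suc:
  "(Suc N choose (Suc N div 2)) + (Suc N choose (N div 2)) = (Suc (Suc N) choose (Suc (Suc N) div 2))"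
proof (cases "even N")
  case True
  then obtain f where "N = 2 * f" by blast
  then show ?thesis
    using binomial_Suc_times_two[of f] by simp
next
  case False
  then obtain f where "N = 2 * f + 1" by (blast elim: oddE)
  then show ?thesis by simp
qed

text \<open>The two closed forms feed each other in the induction. A nonempty column forces an empty
  successor, so only \<open>v\<close> enters the second form.\<close>

lemma card_valid_lists:
  "card (valid_lists N u 0) = (Suc N + u) choose (Suc N div 2) \<and>
    card (valid_lists N u (Suc v)) = (N + Suc v) choose (N div 2)"
proof (induction N arbitrary: u v)
  case 0
  show ?case by (simp add: valid_lists_0)
next
  case (Suc N)
  have nonzero: "card (valid_lists (Suc N) u (Suc v)) = (Suc N + Suc v) choose (Suc N div 2)"
    by (simp add: card_valid_lists_Suc_Suc Suc.IH)
  have "card (valid_lists (Suc N) u 0) =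
      (Suc N choose (Suc N div 2)) + (\<Sum>v\<le>u. (N + Suc v) choose (N div 2))"
    by (simp add: card_valid_lists_Suc_0 Suc.IH)
  \<comment> \<open>The term \<open>v = 0\<close> is split off to merge with the leading summand;
    the result is the starting term of a hockey-stick sum over the rest.\<close>
  also have "(\<Sum>v\<le>u. (N + Suc v) choose (N div 2)) =
      (Suc N choose (N div 2)) + (\<Sum>v<u. (Suc (Suc N) + v) choose (N div 2))"
    by (cases u) (simp_all add: sum.atMost_Suc_shift lessThan_Suc_atMost del: sum.atMost_Suc)
  also have "(Suc N choose (Suc N div 2)) + \<dots> =
      (Suc (Suc N) choose Suc (N div 2)) + (\<Sum>v<u. (Suc (Suc N) + v) choose (N div 2))"
    using binomial_half_Suc[of N] by simp
  also have "\<dots> = (Suc (Suc N) + u) choose Suc (N div 2)"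
    using sum_binomial_upper[of "Suc (Suc N)" "N div 2" "u - 1"]
    by (cases u) (simp_all add: lessThan_Suc_atMost del: binomial_Suc_Suc)
  finally have "card (valid_lists (Suc N) u 0) = (Suc (Suc N) + u) choose (Suc (Suc N) div 2)"
    by simp
  then show ?case using nonzero by blast
qed

text \<open>The padding shifts indices: entry \<open>j\<close> of \<open>v # ws\<close> is one
  column before \<open>ws ! j\<close>, entry \<open>j\<close> of \<open>u # v # ws\<close> two
  columns before.\<close>

lemma valid_iff_nth:
  "valid u v ws \<longleftrightarrow> (\<forall>j<length ws. ws ! j \<le> (u # v # ws) ! j + 1 \<and>
     (ws ! j = 0 \<or> (v # ws) ! j = 0))"
  by (induction u v ws rule: valid.induct) (auto simp: All_less_Suc2)

section \<open>The poset in coordinates\<close>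

lemma gap_setD: "x \<in> gap_set s t \<Longrightarrow> x \<noteq> a * s + b * t"
  by (auto simp: gap_set_def)

text \<open>A representation of \<open>x\<close> by \<open>s\<close> and \<open>t\<close> would
  extend to one of the larger element.\<close>

lemma gap_set_downward:
  assumes "x + a * s + b * t \<in> gap_set s t" "0 < x"
  shows "x \<in> gap_set s t"
proof -
  have "x \<noteq> c * s + d * t" for c d
    using gap_setD[OF assms(1), of "c + a" "d + b"] by (auto simp: algebra_simps)
  then show ?thesis
    using assms(2) by (auto simp: gap_set_def)
qed

lemma gap_cover_rtranclD: "(y, x) \<in> (gap_cover s t)\<^sup>* \<Longrightarrow> \<exists>a b. x = y + a * s + b * t"
proof (induction rule: rtrancl_induct)
  case base
  have "y = y + 0 * s + 0 * t" by simp
  then show ?case by blast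
next
  case (step x z)
  then obtain a b where "x = y + a * s + b * t" by blast
  moreover have "z = x + s \<or> z = x + t"
    using step.hyps(2) by (auto simp: gap_cover_def)
  ultimately have "z = y + Suc a * s + b * t \<or> z = y + a * s + Suc b * t"
    by auto
  then show ?case by blast
qed

text \<open>The chain takes the \<open>s\<close>-steps first, then the \<open>t\<close>-steps; it
  never leaves the gaps, since each of its points is positive and below the gap at its end.\<close>

lemma gap_le_add:
  assumes "0 < y" "y + a * s + b * t \<in> gap_set s t"
  shows "(y, y + a * s + b * t) \<in> gap_le s t"
proof -
  have y: "y \<in> gap_set s t"
    using gap_set_downward assms(2,1) by blast
  have cover: "(x, x + s) \<in> gap_cover s t" if "x + s \<in> gap_set s t" "0 < x" for x
    using that gap_set_downward[of x 1 s 0 t] by (simp add: gap_cover_def)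
  have cover': "(x, x + t) \<in> gap_cover s t" if "x + t \<in> gap_set s t" "0 < x" for x
    using that gap_set_downward[of x 0 s 1 t] by (simp add: gap_cover_def)
  have "(y, y + a * s + b * t) \<in> (gap_cover s t)\<^sup>*"
    using assms(2)
  proof (induction b)
    case 0
    then show ?case
    proof (induction a)
      case 0
      show ?case by simp
    next
      case (Suc a)
      have z: "y + a * s + s \<in> gap_set s t" using Suc.prems by (simp add: algebra_simps)
      then have "y + a * s \<in> gap_set s t"
        using gap_set_downward[of "y + a * s" 1 s 0 t] assms(1) by simp
      then have "(y, y + a * s) \<in> (gap_cover s t)\<^sup>*" using Suc.IH by simp
      with cover[OF z] assms(1) show ?case
        by (auto simp: algebra_simps intro: rtrancl_into_rtrancl)
    qed
  next
    case (Suc b)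
    have z: "y + a * s + b * t + t \<in> gap_set s t" using Suc.prems by (simp add: algebra_simps)
    then have "y + a * s + b * t \<in> gap_set s t"
      using gap_set_downward[of "y + a * s + b * t" 0 s 1 t] assms(1) by simp
    then have "(y, y + a * s + b * t) \<in> (gap_cover s t)\<^sup>*" by (rule Suc.IH)
    with cover'[OF z] assms(1) show ?case
      by (auto simp: algebra_simps intro: rtrancl_into_rtrancl)
  qed
  then show ?thesis
    using y assms(2) by (simp add: gap_le_def)
qed

lemma gap_le_iff:
  "(y, x) \<in> gap_le s t \<longleftrightarrow>
    y \<in> gap_set s t \<and> x \<in> gap_set s t \<and> (\<exists>a b. x = y + a * s + b * t)"
proof
  assume "(y, x) \<in> gap_le s t"
  then show "y \<in> gap_set s t \<and> x \<in> gap_set s t \<and> (\<exists>a b. x = y + a * s + b * t)"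
    using gap_cover_rtranclD unfolding gap_le_def by blast
next
  assume *: "y \<in> gap_set s t \<and> x \<in> gap_set s t \<and> (\<exists>a b. x = y + a * s + b * t)"
  then obtain a b where "x = y + a * s + b * t" by blast
  moreover have "0 < y" using * by (simp add: gap_set_def)
  ultimately show "(y, x) \<in> gap_le s t" using gap_le_add * by simp
qed

lemma gap_le_iff_add:
  "x \<in> gap_set s t \<Longrightarrow> 0 < y \<Longrightarrow> (y, x) \<in> gap_le s t \<longleftrightarrow> (\<exists>a b. x = y + a * s + b * t)"
  using gap_le_iff gap_le_add by blast

text \<open>Since \<open>a * s + b * (s + 2) = (a + b) * s + 2 * b\<close>, an even
  \<open>n \<le> 2 * m\<close> makes \<open>x\<close> representable, and an odd one makes it
  \<open>s + 1\<close> plus a representable number. Either way \<open>x\<close> is excluded.\<close>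

lemma M_set_iff:
  "x \<in> M_set k \<longleftrightarrow> 2 * (x div (2 * k + 1)) < x mod (2 * k + 1)"
proof -
  define s m n where "s = 2 * k + 1" and "m = x div s" and "n = x mod s"
  have x: "x = m * s + n" by (simp add: m_def n_def)
  have n: "n < s" by (simp add: n_def s_def)
  have M: "x \<in> M_set k \<longleftrightarrow> x \<in> gap_set s (s + 2) \<and> (\<nexists>a b. x = s + 1 + a * s + b * (s + 2))"
  proof -
    have "2 * k + 3 = s + 2" "2 * k + 2 = s + 1" by (simp_all add: s_def)
    then have M: "x \<in> M_set k \<longleftrightarrow> x \<in> gap_set s (s + 2) \<and> (s + 1, x) \<notin> gap_le s (s + 2)"
      unfolding M_set_def by (simp only: s_def[symmetric] mem_Collect_eq)
    have "0 < s + 1" by simp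
    show ?thesis
    proof (cases "x \<in> gap_set s (s + 2)")
      case True
      show ?thesis unfolding M gap_le_iff_add[OF True \<open>0 < s + 1\<close>] by (rule refl)
    next
      case False
      then show ?thesis by (simp only: M simp_thms)
    qed
  qed
  have "2 * m < n" if "x \<in> M_set k"
  proof (rule ccontr)
    assume "\<not> 2 * m < n"
    then have le: "n \<le> 2 * m" by simp
    show False
    proof (cases "even n")
      case True
      then obtain b where b: "n = 2 * b" by blast
      with le obtain a where "m = a + b" by (metis le_add_diff_inverse2 mult_le_cancel1 zero_less_numeral)
      with b have "x = a * s + b * (s + 2)" by (simp add: x algebra_simps)
      with that show False using M gap_setD by blast
    next
      case False
      then obtain b where b: "n = 2 * b + 1" by (blast elim: oddE)
      with le have "Suc b \<le> m" by simp
      then obtain a where "m = Suc b + a" using le_Suc_ex by blast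
      with b have "x = s + 1 + a * s + b * (s + 2)" by (simp add: x algebra_simps)
      with that show False using M by blast
    qed
  qed
  moreover have "x \<in> M_set k" if less: "2 * m < n"
  proof -
    \<comment> \<open>This form covers both reasons for exclusion: \<open>e = 0\<close> for
      non-gaps, \<open>e = 1\<close> for elements above \<open>s + 1\<close>.\<close>
    have rep: "x \<noteq> c * s + 2 * b + e * (s + 1)" if "b \<le> c" for b c e
    proof
      assume eq: "x = c * s + 2 * b + e * (s + 1)"
      have "(c + e) * s \<le> x" by (simp add: eq algebra_simps)
      also have "x < Suc m * s" using n by (simp add: x)
      finally have ce: "c + e \<le> m" by (metis mult_less_cancel2 less_Suc_eq_le)
      then obtain d where d: "m = c + e + d" using le_Suc_ex by blast
      \<comment> \<open>Cancelling \<open>(c + e) * s\<close> leaves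
        \<open>d * s + n = 2 * b + e\<close>, and
        \<open>2 * b + e \<le> 2 * (c + e) \<le> 2 * m\<close>.\<close>
      have "n \<le> 2 * b + e"
        using eq by (simp add: x d algebra_simps)
      with that ce less show False by simp
    qed
    have "x \<noteq> a * s + b * (s + 2)" for a b
      using rep[of b "a + b" 0] by (simp add: algebra_simps)
    moreover have "x \<noteq> s + 1 + a * s + b * (s + 2)" for a b
      using rep[of b "a + b" 1] by (simp add: algebra_simps)
    moreover have "0 < x" using less by (simp add: x)
    ultimately show ?thesis unfolding M by (auto simp: gap_set_def)
  qed
  ultimately show ?thesis by (auto simp: m_def n_def s_def)
qed

lemma M_le_iff:
  "(x, y) \<in> M_le k \<longleftrightarrow> x \<in> M_set k \<and> y \<in> M_set k \<and>
    (\<exists>a b. y = x + a * (2 * k + 1) + b * (2 * k + 3))"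
  by (auto simp: M_le_def gap_le_iff M_set_def)

section \<open>Ideals from column heights\<close>

text \<open>The prepended \<open>0\<close> is the height of column \<open>0\<close>, so that column \<open>n\<close> has height \<open>(0 # ws) ! n\<close>.\<close>

definition ideal_of :: "nat \<Rightarrow> nat list \<Rightarrow> nat set" where
  "ideal_of s ws = {x. x div s < (0 # ws) ! (x mod s)}"

lemma mem_ideal_of: "n < s \<Longrightarrow> m * s + n \<in> ideal_of s ws \<longleftrightarrow> m < (0 # ws) ! n"
  by (simp add: ideal_of_def)

text \<open>Entry \<open>j\<close> is recovered from the rows that the ideal occupies in column
  \<open>Suc j\<close>.\<close>

lemma inj_on_ideal_of: "inj_on (ideal_of (Suc N)) {ws. length ws = N}"
proof (rule inj_onI)
  fix vs ws :: "nat list"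
  assume len: "vs \<in> {ws. length ws = N}" "ws \<in> {ws. length ws = N}"
    and eq: "ideal_of (Suc N) vs = ideal_of (Suc N) ws"
  have "vs ! j = ws ! j" if "j < N" for j
  proof -
    have "m < vs ! j \<longleftrightarrow> m < ws ! j" for m
      using mem_ideal_of[of "Suc j" "Suc N" m] that eq by fastforce
    then show ?thesis by (meson less_irrefl linorder_neqE_nat)
  qed
  then show "vs = ws"
    using len by (simp add: list_eq_iff_nth_eq)
qed

text \<open>Entry \<open>n\<close> of \<open>0 # 0 # ws\<close> is the height of column
  \<open>n - 1\<close>; the fictitious empty column -1 bounds the height of column 1 by 1.\<close>

lemma valid_heights:
  assumes "valid 0 0 ws"
  shows "n < length ws \<Longrightarrow> (0 # ws) ! (n + 1) \<le> (0 # 0 # ws) ! n + 1"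
    and "n < length ws \<Longrightarrow> (0 # ws) ! (n + 1) = 0 \<or> (0 # ws) ! n = 0"
  using assms by (auto simp: valid_iff_nth)

text \<open>Heights rise by at most 1 every two columns. The bound says that the top row
  \<open>m = h - 1\<close> of a nonempty column satisfies \<open>2 * m < n\<close>, which keeps the
  ideal inside \<open>M_set\<close>.\<close>

lemma valid_height_le:
  assumes "valid 0 0 ws" "n \<le> length ws"
  shows "2 * (0 # ws) ! n \<le> n + 1"
  using assms(2)
proof (induction n rule: less_induct)
  case (less n)
  consider "n = 0" | "n = 1" | j where "n = j + 2"
    by (metis One_nat_def add_2_eq_Suc' not0_implies_Suc)
  then show ?case
  proof cases
    case 1
    then show ?thesis by simp
  next
    case 2
    then show ?thesis using valid_heights(1)[OF assms(1), of 0] less.prems 2 by (cases ws) auto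
  next
    case 3
    then show ?thesis
      using valid_heights(1)[OF assms(1), of "j + 1"] less.IH[of j] less.prems by simp
  qed
qed

lemma ideal_of_diff_s:
  assumes "x + s \<in> ideal_of s ws" "0 < s"
  shows "x \<in> ideal_of s ws"
  using assms by (simp add: ideal_of_def)

text \<open>From the last two columns, adding \<open>s + 2\<close> wraps around to column 0, which
  is empty, or to row \<open>m + 2\<close> of column 1, which has height at most 1.\<close>

lemma ideal_of_diff_t:
  assumes "valid 0 0 ws" "length ws = 2 * k" "x + (2 * k + 3) \<in> ideal_of (2 * k + 1) ws"
  shows "x \<in> ideal_of (2 * k + 1) ws"
proof -
  define s m n where "s = 2 * k + 1" and "m = x div s" and "n = x mod s"
  have x: "x = m * s + n" by (simp add: m_def n_def)
  have n: "n < s" by (simp add: n_def s_def)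
  have I: "x + (2 * k + 3) \<in> ideal_of s ws" using assms(3) by (simp add: s_def)
  have h1: "(0 # ws) ! 1 \<le> 1" if "1 < s"
    using valid_heights(1)[OF assms(1), of 0] that assms(2) by (simp add: s_def)
  show ?thesis
  proof (cases "n + 2 < s")
    case True
    have "x + (2 * k + 3) = (m + 1) * s + (n + 2)" by (simp add: x s_def)
    from I[unfolded this mem_ideal_of[OF True]] have "m + 1 < (0 # ws) ! (n + 2)" .
    also have "\<dots> \<le> (0 # ws) ! n + 1"
      using valid_heights(1)[OF assms(1), of "n + 1"] True assms(2) by (simp add: s_def)
    finally show ?thesis
      unfolding x s_def[symmetric] mem_ideal_of[OF n] by simp
  next
    case False
    then consider "n + 2 = s" | "n + 1 = s" using n by linarith
    then have False
    proof cases
      case 1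
      then have "x + (2 * k + 3) = (m + 2) * s + 0" by (simp add: x s_def)
      from I[unfolded this] mem_ideal_of[of 0 s "m + 2" ws] show False by (simp add: s_def)
    next
      case 2
      show False
      \<comment> \<open>For \<open>k = 0\<close> there is no column 1: \<open>s = 1\<close> and the
        ideal is empty.\<close>
      proof (cases "k = 0")
        case True
        then show False using assms(3) by (simp add: ideal_of_def)
      next
        case False
        then have "1 < s" by (simp add: s_def)
        moreover have "x + (2 * k + 3) = (m + 2) * s + 1" using 2 by (simp add: x s_def)
        ultimately have "m + 2 < (0 # ws) ! 1"
          using I mem_ideal_of[of 1 s "m + 2" ws] by (simp only:)
        then show False using h1[OF \<open>1 < s\<close>] by simp
      qed
    qed
    then show ?thesis ..
  qed
qed

lemma order_ideal_ideal_of: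
  assumes "valid 0 0 ws" "length ws = 2 * k"
  shows "order_ideal (M_set k) (M_le k) (ideal_of (2 * k + 1) ws)"
proof -
  have down: "x \<in> ideal_of (2 * k + 1) ws"
    if "x + a * (2 * k + 1) + b * (2 * k + 3) \<in> ideal_of (2 * k + 1) ws" for x a b
    using that
  proof (induction b)
    case 0
    then show ?case
    proof (induction a)
      case (Suc a)
      then show ?case
        using ideal_of_diff_s[of "x + a * (2 * k + 1)" "2 * k + 1" ws] by (simp add: algebra_simps)
    qed simp
  next
    case (Suc b)
    then show ?case
      using ideal_of_diff_t[OF assms, of "x + a * (2 * k + 1) + b * (2 * k + 3)"]
      by (simp add: algebra_simps)
  qed
  have "x \<in> M_set k" if "x \<in> ideal_of (2 * k + 1) ws" for x
  proof -
    have "x mod (2 * k + 1) \<le> length ws"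
      unfolding assms(2) using mod_less_divisor[of "2 * k + 1" x] by linarith
    from valid_height_le[OF assms(1) this] show ?thesis
      using that unfolding M_set_iff ideal_of_def by simp
  qed
  then show ?thesis
    using down unfolding order_ideal_def M_le_iff by blast
qed

text \<open>Consecutive numbers lie in one row of adjacent columns, or the larger one lies in the
  empty column 0.\<close>

lemma nice_ideal_of:
  assumes "valid 0 0 ws" "length ws = 2 * k"
  shows "nice (ideal_of (2 * k + 1) ws)"
  unfolding nice_def
proof (intro notI, elim bexE)
  fix x y
  assume x: "x \<in> ideal_of (2 * k + 1) ws" and y: "y \<in> ideal_of (2 * k + 1) ws" and "x = y + 1"
  define s m n where "s = 2 * k + 1" and "m = y div s" and "n = y mod s"
  have y_eq: "y = m * s + n" by (simp add: m_def n_def)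
  have n: "n < s" by (simp add: n_def s_def)
  have hn: "m < (0 # ws) ! n" using y mem_ideal_of[OF n] by (simp add: y_eq s_def)
  show False
  proof (cases "n + 1 < s")
    case True
    have "m < (0 # ws) ! (n + 1)"
      using x mem_ideal_of[OF True, of m ws] by (simp add: \<open>x = y + 1\<close> y_eq s_def add.assoc)
    with hn show False
      using valid_heights(2)[OF assms(1), of n] True assms(2) by (simp add: s_def)
  next
    case False
    with n have "x = (m + 1) * s + 0" by (simp add: \<open>x = y + 1\<close> y_eq)
    with x mem_ideal_of[of 0 s "m + 1" ws] show False by (simp add: s_def)
  qed
qed

lemma ideal_of_surj:
  assumes ideal: "order_ideal (M_set k) (M_le k) I" and "nice I"
  shows "\<exists>ws\<in>valid_lists (2 * k) 0 0. I = ideal_of (2 * k + 1) ws"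
proof -
  define s where "s = 2 * k + 1"
  have M: "m * s + n \<in> M_set k \<longleftrightarrow> 2 * m < n" if "n < s" for m n
    using that unfolding M_set_iff s_def[symmetric] by simp
  have sub: "2 * m < n" if "m * s + n \<in> I" "n < s" for m n
    using ideal that M by (auto simp: order_ideal_def)
  have down: "x \<in> I" if "y \<in> I" "x \<in> M_set k" "y = x + a * s + b * (s + 2)" for x y a b
  proof -
    have "2 * k + 3 = s + 2" by (simp add: s_def)
    moreover have "y \<in> M_set k" using ideal that(1) by (auto simp: order_ideal_def)
    ultimately have "(x, y) \<in> M_le k"
      using that(2,3) unfolding M_le_iff s_def[symmetric] by (metis (no_types))
    then show ?thesis using ideal that(1,2) unfolding order_ideal_def by blast
  qed
  \<comment> \<open>The first missing row is the height: inside \<open>M_set\<close> each column of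
    \<open>I\<close> is closed under subtracting \<open>s\<close>, so it is an initial
    segment.\<close>
  define h where "h n = (LEAST m. m * s + n \<notin> I)" for n
  have h: "m * s + n \<in> I \<longleftrightarrow> m < h n" if "n < s" for m n
  proof
    assume "m < h n"
    then show "m * s + n \<in> I" unfolding h_def using not_less_Least by blast
  next
    assume I: "m * s + n \<in> I"
    show "m < h n"
    proof (rule ccontr)
      assume "\<not> m < h n"
      then obtain a where a: "m = h n + a" using le_Suc_ex not_less by blast
      then have "h n * s + n \<in> M_set k" using sub[OF I that] M[OF that] by simp
      then have "h n * s + n \<in> I"
        using down[OF I, of _ a 0] a by (simp add: algebra_simps)
      \<comment> \<open>Row \<open>n\<close> violates \<open>2 * m < n\<close> and witnesses that
        the least missing row exists.\<close>
      moreover have "n * s + n \<notin> I" using sub[of n n] that by auto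
      then have "h n * s + n \<notin> I" unfolding h_def by (rule LeastI)
      ultimately show False by blast
    qed
  qed
  have h0: "h 0 = 0"
    using h[of 0 0] sub[of 0 0] by (auto simp: s_def)
  have h1: "h 1 \<le> 1" if "1 < s"
    using h[of 1 1] sub[of 1 1] that by force
  \<comment> \<open>Otherwise row \<open>h n + 1\<close> of column \<open>n + 2\<close> would be
    filled, and subtracting \<open>s + 2\<close> would put the missing point in row
    \<open>h n\<close> of column \<open>n\<close> into \<open>I\<close>.\<close>
  have step: "h (n + 2) \<le> h n + 1" if "n + 2 < s" for n
  proof (rule ccontr)
    assume "\<not> h (n + 2) \<le> h n + 1"
    then have I: "(h n + 1) * s + (n + 2) \<in> I" unfolding h[OF that] by simp
    from sub[OF I that] have "h n * s + n \<in> M_set k" using M that by simp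
    from down[OF I this, of 0 1] have "h n * s + n \<in> I" by simp
    then show False using h[of n "h n"] that by simp
  qed
  \<comment> \<open>Nonempty columns contain their row 0, that is, the numbers \<open>n\<close> and
    \<open>n + 1\<close> themselves.\<close>
  have apart: "h (n + 1) = 0 \<or> h n = 0" if "n + 1 < s" for n
  proof (rule ccontr)
    assume "\<not> (h (n + 1) = 0 \<or> h n = 0)"
    then have "n + 1 \<in> I" "n \<in> I" using h[of "n + 1" 0] h[of n 0] that by auto
    then show False using \<open>nice I\<close> by (auto simp: nice_def)
  qed
  define ws where "ws = map (\<lambda>j. h (Suc j)) [0..<2 * k]"
  have nth: "(0 # ws) ! n = h n" if "n < s" for n
    using that h0 by (cases n) (auto simp: ws_def s_def)
  have "valid 0 0 ws"
    unfolding valid_iff_nth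
  proof (intro allI impI conjI)
    fix j assume "j < length ws"
    then have j: "Suc j < s" by (simp add: ws_def s_def)
    then have wj: "ws ! j = h (Suc j)" using nth[of "Suc j"] by simp
    show "ws ! j = 0 \<or> (0 # ws) ! j = 0"
      using apart[of j] j nth[of j] by (simp add: wj)
    show "ws ! j \<le> (0 # 0 # ws) ! j + 1"
    proof (cases j)
      case 0
      then show ?thesis using h1 j wj by simp
    next
      case (Suc i)
      then show ?thesis using step[of i] j nth[of i] wj by simp
    qed
  qed
  then have "ws \<in> valid_lists (2 * k) 0 0" by (simp add: valid_lists_def ws_def)
  moreover have "I = ideal_of s ws"
  proof (rule set_eqI)
    fix x
    have "x mod s < s" by (simp add: s_def)
    from h[OF this, of "x div s"] nth[OF this]
    show "x \<in> I \<longleftrightarrow> x \<in> ideal_of s ws" by (simp add: ideal_of_def)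
  qed
  ultimately show ?thesis unfolding s_def by blast
qed

text \<open>The lists have length \<open>2 * k\<close>, one entry per column from 1 on; the initial
  heights \<open>0 0\<close> stand for columns -1 and 0.\<close>

lemma card_nice_ideals:
  "card {I. order_ideal (M_set k) (M_le k) I \<and> nice I} = (2 * k + 1) choose k"
proof -
  have "inj_on (ideal_of (2 * k + 1)) (valid_lists (2 * k) 0 0)"
    using inj_on_ideal_of[of "2 * k"] by (auto simp: valid_lists_def intro: inj_on_subset)
  moreover have "{I. order_ideal (M_set k) (M_le k) I \<and> nice I} =
      ideal_of (2 * k + 1) ` valid_lists (2 * k) 0 0"
    using ideal_of_surj order_ideal_ideal_of nice_ideal_of
    by (auto simp: valid_lists_def)
  ultimately show ?thesis
    by (simp add: card_image card_valid_lists)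
qed

theorem theorem4:
  fixes k :: nat
  shows "real (card {I. order_ideal (M_set k) (M_le k) I \<and> nice I}) =
    (\<Sum>i=0..k. 1 / real (i + 1) * real ((2 * i) choose i) * real ((2 * k - 2 * i) choose (k - i)))"
  by (simp only: card_nice_ideals catalan_central_convolution)

end
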